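(* Let $2<r<\infty$, let $\nu$ be an admissible function for the space $G(\nu;r)$ (see context), let $\xi\in G(\nu;r)$ be a random variable with $\mathbf{E}\xi=0$, let $\xi(k)$, $k=1,2,\dots$, be independent copies of $\xi$, and put $$U(x)=\sup_{n\ge1}\mathbf{P}\left(\left|n^{-1/2}\sum_{k=1}^n\xi(k)\right|\ge x\right).$$ Then there is a finite constant $C$ depending only on $r$ and the law of $\xi$ such that for all $x>0$ $$U(x)\le C\,T^{(\nu)}(x),\qquad\text{where } T^{(\nu)}(x)=\inf_{p\in(1,r)}\left[\nu(p)^p/x^p\right].$$
   Context: Notation: $|\xi|_p=[\mathbf{E}|\xi|^p]^{1/p}$. Let $2<r<\infty$ and let $\nu$ be a continuous positive function on $[1,r)$ with $\inf_{p\in(2,r)}\nu(p)>0$, and $\nu(p)=\infty$ for $p>r$ (such $\nu$ is called admissible). The space $G(\nu)=G(\nu;r)$ consists of all random variables (on a fixed probability space) with finite norm $\|\xi\|_{G(\nu;r)}=\sup_{p\in(2,r)}|\xi|_p/\nu(p)$.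
   Formalization: The constant C is allowed to depend on ν as well as on r and the law of ξ; without this the claim fails (for ξ=±1 and ν=ε on [1,r), U(1)=1 while T(1)=ε^r tends to 0). Formally C is also chosen after the types of the sample spaces. *)

theory Defs
  imports "HOL-Probability.Probability"
begin

text \<open>Real powers of extended nonnegative numbers; only used with exponents \<open>p > 0\<close>, where
  \<open>\<infinity>\<close> to the power \<open>p\<close> is \<open>\<infinity>\<close>.\<close>

definition ennreal_powr :: "ennreal \<Rightarrow> real \<Rightarrow> ennreal" where
  "ennreal_powr a p = (if a = \<infinity> then \<infinity> else ennreal (enn2real a powr p))"

text \<open>The norm \<open>(E |\<xi>|^p)^(1/p)\<close>, with value \<open>\<infinity>\<close> when the \<open>p\<close>-th moment is infinite (hence the
  nonnegative integral rather than the Bochner integral, which would give 0 in that case).\<close>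

definition Lp_norm :: "'a measure \<Rightarrow> real \<Rightarrow> ('a \<Rightarrow> real) \<Rightarrow> ennreal" where
  "Lp_norm M p \<xi> = ennreal_powr (\<integral>\<^sup>+ \<omega>. ennreal (\<bar>\<xi> \<omega>\<bar> powr p) \<partial>M) (1 / p)"

definition admissible :: "(real \<Rightarrow> ennreal) \<Rightarrow> real \<Rightarrow> bool" where
  "admissible \<nu> r \<longleftrightarrow>
     continuous_on {1..<r} \<nu> \<and>
     (\<forall>p\<in>{1..<r}. 0 < \<nu> p \<and> \<nu> p < \<infinity>) \<and>
     0 < (INF p\<in>{2<..<r}. \<nu> p) \<and>
     (\<forall>p>r. \<nu> p = \<infinity>)"

definition G_norm :: "'a measure \<Rightarrow> (real \<Rightarrow> ennreal) \<Rightarrow> real \<Rightarrow> ('a \<Rightarrow> real) \<Rightarrow> ennreal" where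
  "G_norm M \<nu> r \<xi> = (SUP p\<in>{2<..<r}. Lp_norm M p \<xi> / \<nu> p)"

definition G_space :: "'a measure \<Rightarrow> (real \<Rightarrow> ennreal) \<Rightarrow> real \<Rightarrow> ('a \<Rightarrow> real) set" where
  "G_space M \<nu> r = {\<xi> \<in> borel_measurable M. G_norm M \<nu> r \<xi> < \<infinity>}"

text \<open>The copies are indexed by \<open>k = 1, 2, \<dots>\<close>; the value \<open>X 0\<close> is irrelevant. They may live on a
  space \<open>N\<close> other than that of \<open>\<xi>\<close>, since \<open>M\<close> itself need not be rich enough to carry an
  independent sequence with the law of \<open>\<xi>\<close>; the case \<open>N = M\<close> is included.\<close>

definition independent_copies ::
    "'a measure \<Rightarrow> ('a \<Rightarrow> real) \<Rightarrow> 'b measure \<Rightarrow> (nat \<Rightarrow> 'b \<Rightarrow> real) \<Rightarrow> bool" where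
  "independent_copies M \<xi> N X \<longleftrightarrow>
     prob_space.indep_vars N (\<lambda>_. borel) X {1..} \<and>
     (\<forall>k\<ge>1. distr N borel (X k) = distr M borel \<xi>)"

definition U_tail :: "'b measure \<Rightarrow> (nat \<Rightarrow> 'b \<Rightarrow> real) \<Rightarrow> real \<Rightarrow> real" where
  "U_tail N X x =
     (SUP n\<in>{1..}. measure N {\<omega> \<in> space N. \<bar>real n powr (-1/2) * (\<Sum>k=1..n. X k \<omega>)\<bar> \<ge> x})"

text \<open>Conversion to the reals is harmless here: an admissible \<open>\<nu>\<close> is finite on \<open>(1, r)\<close>.\<close>

definition T_fun :: "(real \<Rightarrow> ennreal) \<Rightarrow> real \<Rightarrow> real \<Rightarrow> real" where
  "T_fun \<nu> r x = (INF p\<in>{1<..<r}. enn2real (\<nu> p) powr p / x powr p)"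

end

theory Submission
  imports Defs
begin

text \<open>
  The heart of the matter is an inequality of Marcinkiewicz--Zygmund type: for independent
  centered \<open>X\<^sub>1, X\<^sub>2, \<dots>\<close> with \<open>E |X\<^sub>k|\<^sup>p \<le> L\<^sup>p\<close>, \<open>p \<ge> 2\<close>, the sum \<open>S\<^sub>n\<close> satisfies
  \<open>E |S\<^sub>n|\<^sup>p \<le> (c\<^sub>p L \<surd>n)\<^sup>p\<close>, where \<open>c\<^sub>p\<close> stays bounded as \<open>p\<close> ranges over \<open>[2, r]\<close>
  (lemma \<open>centered_indep_sum_moment\<close>). It is proved by adding one summand at a time. A second
  order expansion gives
  \<open>|S + Y|\<^sup>p \<le> |S|\<^sup>p + p Y sgn S |S|\<^sup>p\<^sup>-\<^sup>1 + C (|S|\<^sup>p\<^sup>-\<^sup>2 Y\<^sup>2 + |Y|\<^sup>p)\<close>, and the linear term vanishes in the mean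
  because \<open>Y\<close> is centered and independent of \<open>S\<close>. If \<open>S\<close> has size \<open>s\<close> proportional to \<open>L \<surd>n\<close>,
  the remaining terms are of order \<open>L\<^sup>2 s\<^sup>p\<^sup>-\<^sup>2\<close>, just as the increase of \<open>(c\<^sub>p L \<surd>n)\<^sup>p\<close> from \<open>n\<close>
  to \<open>n + 1\<close>.

  Finiteness of the norm in \<open>G(\<nu>)\<close> means \<open>|\<xi>|\<^sub>p \<le> K \<nu>(p)\<close> for \<open>2 < p < r\<close>, so Markov's inequality
  bounds the tail at \<open>x\<close> by \<open>(c\<^sub>r K \<nu>(p) / x)\<^sup>p\<close>, uniformly in \<open>n\<close>. For \<open>1 < p \<le> 2\<close> the norm carries no
  direct information about \<open>|\<xi>|\<^sub>p\<close>. There the bound \<open>(B / x)\<^sup>q\<close> for one fixed \<open>q \<in> (2, r)\<close> is combined with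
  the trivial bound \<open>1\<close> to give \<open>(B / x)\<^sup>p\<close>, and \<open>B\<close> is absorbed into a multiple of \<open>\<nu>(p)\<close>, since a continuous
  positive function is bounded away from \<open>0\<close> on the compact interval \<open>[1, 2]\<close>. Finally all the constants to
  the power \<open>p\<close> are at most one constant to the power \<open>r\<close>, and the infimum over \<open>p\<close> may be taken.
\<close>

section \<open>Elementary inequalities for real powers\<close>

text \<open>The inequality \<open>1 + t \<le> exp t\<close> reduces the claim to the second order Taylor remainder of
  \<open>exp\<close> at \<open>p t\<close>.\<close>

lemma powr_one_plus_le:
  fixes t p :: real
  assumes t: "\<bar>t\<bar> \<le> 1/2" and p: "p \<ge> 2"
  shows "(1 + t) powr p \<le> 1 + p * t + p\<^sup>2 * 3 powr p * t\<^sup>2"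
proof -
  have le_exp: "(1 + t) powr p \<le> exp (p * t)"
  proof -
    have "(1 + t) powr p \<le> exp t powr p"
      using t p exp_ge_add_one_self[of t] by (intro powr_mono2) auto
    then show ?thesis by (simp add: powr_def)
  qed
  obtain s where s: "\<bar>s\<bar> \<le> \<bar>p * t\<bar>"
      "exp (p * t) = (\<Sum>m<2. (p * t) ^ m / fact m) + exp s / fact 2 * (p * t) ^ 2"
    using Maclaurin_exp_le[of "p * t" 2] by blast
  have "exp s \<le> exp p"
  proof -
    have "s \<le> \<bar>p * t\<bar>" using s(1) by linarith
    also have "\<dots> \<le> p" using t p by (simp add: abs_mult mult_left_le)
    finally show ?thesis by simp
  qed
  also have "exp p = exp 1 powr p" by (simp add: powr_def)
  also have "\<dots> \<le> 3 powr p" using exp_le p by (intro powr_mono2) auto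
  finally have "exp s / 2 * (p * t)\<^sup>2 \<le> 3 powr p * (p * t)\<^sup>2"
    by (intro mult_right_mono) (auto simp: field_simps intro: order_trans[of _ "3 powr p"])
  then have "exp (p * t) \<le> 1 + p * t + p\<^sup>2 * 3 powr p * t\<^sup>2"
    unfolding s(2) by (simp add: numeral_2_eq_2 power_mult_distrib algebra_simps)
  with le_exp show ?thesis by linarith
qed

text \<open>For \<open>b\<close> small relative to \<open>a\<close> this is the previous lemma rescaled by \<open>\<bar>a\<bar>\<close>, with \<open>t = b / a\<close>.
  Otherwise \<open>\<bar>a\<bar> \<le> 2 \<bar>b\<bar>\<close>, and every term is at most a multiple of \<open>\<bar>b\<bar> powr p\<close>. Splitting this way
  avoids differentiating \<open>\<bar>a\<bar> powr p\<close> at the origin.\<close>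

lemma abs_powr_add_le:
  fixes a b p :: real
  assumes p: "p \<ge> 2"
  shows "\<bar>a + b\<bar> powr p \<le> \<bar>a\<bar> powr p + p * (sgn a * \<bar>a\<bar> powr (p - 1)) * b
           + p\<^sup>2 * 3 powr p * (\<bar>a\<bar> powr (p - 2) * b\<^sup>2 + \<bar>b\<bar> powr p)"
proof (cases "\<bar>b\<bar> \<le> \<bar>a\<bar> / 2 \<and> a \<noteq> 0")
  case True
  define t where "t = b / a"
  have t: "\<bar>t\<bar> \<le> 1/2" using True by (simp add: t_def abs_divide field_simps)
  have ab: "a + b = a * (1 + t)" using True by (simp add: t_def field_simps)
  have e1: "\<bar>a\<bar> powr p * t = sgn a * \<bar>a\<bar> powr (p - 1) * b"
    using True by (simp add: t_def powr_diff sgn_if field_simps)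
  have e2: "\<bar>a\<bar> powr p * t\<^sup>2 = \<bar>a\<bar> powr (p - 2) * b\<^sup>2"
    using True by (simp add: t_def powr_diff power2_eq_square field_simps)
  have "\<bar>a + b\<bar> powr p = \<bar>a\<bar> powr p * (1 + t) powr p"
    using t by (simp add: ab abs_mult powr_mult)
  also have "\<dots> \<le> \<bar>a\<bar> powr p * (1 + p * t + p\<^sup>2 * 3 powr p * t\<^sup>2)"
    by (intro mult_left_mono powr_one_plus_le t p) auto
  also have "\<dots> = \<bar>a\<bar> powr p + p * (\<bar>a\<bar> powr p * t) + p\<^sup>2 * 3 powr p * (\<bar>a\<bar> powr p * t\<^sup>2)"
    by (simp add: algebra_simps)
  also have "\<dots> \<le> \<bar>a\<bar> powr p + p * (sgn a * \<bar>a\<bar> powr (p - 1)) * b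
           + p\<^sup>2 * 3 powr p * (\<bar>a\<bar> powr (p - 2) * b\<^sup>2 + \<bar>b\<bar> powr p)"
    unfolding e1 e2 by (simp add: algebra_simps)
  finally show ?thesis .
next
  case False
  then have ab: "\<bar>a\<bar> \<le> 2 * \<bar>b\<bar>" by auto
  have "\<bar>a + b\<bar> powr p \<le> (3 * \<bar>b\<bar>) powr p"
    using ab p by (intro powr_mono2) auto
  then have 1: "\<bar>a + b\<bar> powr p \<le> 3 powr p * \<bar>b\<bar> powr p" by (simp add: powr_mult)
  have "- (p * (sgn a * \<bar>a\<bar> powr (p - 1)) * b) \<le> \<bar>p * (sgn a * \<bar>a\<bar> powr (p - 1)) * b\<bar>"
    by linarith
  also have "\<dots> \<le> p * (3 * \<bar>b\<bar>) powr (p - 1) * \<bar>b\<bar>"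
  proof -
    have "\<bar>a\<bar> powr (p - 1) \<le> (3 * \<bar>b\<bar>) powr (p - 1)"
      using ab p by (intro powr_mono2) auto
    then have "\<bar>sgn a * \<bar>a\<bar> powr (p - 1)\<bar> \<le> (3 * \<bar>b\<bar>) powr (p - 1)"
      by (auto simp: sgn_if abs_mult)
    then show ?thesis using p by (simp add: abs_mult mult_mono)
  qed
  also have "\<dots> = p * (3 powr (p - 1)) * \<bar>b\<bar> powr p"
    by (cases "b = 0") (auto simp: powr_mult powr_diff)
  also have "\<dots> \<le> p * 3 powr p * \<bar>b\<bar> powr p"
    using p by (intro mult_right_mono mult_left_mono powr_mono) auto
  finally have 2: "- (p * (sgn a * \<bar>a\<bar> powr (p - 1)) * b) \<le> p * 3 powr p * \<bar>b\<bar> powr p" .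
  have "1 + p \<le> p\<^sup>2" using p mult_right_mono[of 2 p p] unfolding power2_eq_square by linarith
  then have "(1 + p) * (3 powr p * \<bar>b\<bar> powr p) \<le> p\<^sup>2 * (3 powr p * \<bar>b\<bar> powr p)"
    by (intro mult_right_mono) auto
  with 1 2 have "\<bar>a + b\<bar> powr p - p * (sgn a * \<bar>a\<bar> powr (p - 1)) * b \<le> p\<^sup>2 * 3 powr p * \<bar>b\<bar> powr p"
    by (simp add: algebra_simps)
  also have "\<dots> \<le> \<bar>a\<bar> powr p + p\<^sup>2 * 3 powr p * (\<bar>a\<bar> powr (p - 2) * b\<^sup>2 + \<bar>b\<bar> powr p)"
    by (simp add: algebra_simps)
  finally show ?thesis by simp
qed

text \<open>Applied to random variables with \<open>s\<close> of the order of the \<open>p\<close>-norm, this compares a lower moment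
  with the \<open>p\<close>-th one, at the price of a factor 2 compared with Jensen's inequality.\<close>

lemma powr_le_truncated:
  fixes u s p q :: real
  assumes "0 < s" "0 \<le> u" "0 \<le> q" "q \<le> p"
  shows "u powr q \<le> s powr q + s powr (q - p) * u powr p"
proof (cases "u \<le> s")
  case True
  then have "u powr q \<le> s powr q" using assms by (intro powr_mono2) auto
  then show ?thesis by (simp add: add_increasing2)
next
  case False
  then have "u powr q = u powr (q - p) * u powr p" by (simp flip: powr_add)
  also have "\<dots> \<le> s powr (q - p) * u powr p"
    using False assms by (intro mult_right_mono powr_mono2') auto
  finally show ?thesis by (simp add: add_increasing)
qed

section \<open>Moments and tails of sums of independent centered variables\<close>

context prob_space
begin

lemma integrable_abs_powr_le:
  fixes Y :: "'a \<Rightarrow> real"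
  assumes [measurable]: "random_variable borel Y"
    and "integrable M (\<lambda>\<omega>. \<bar>Y \<omega>\<bar> powr p)" "0 \<le> q" "q \<le> p"
  shows "integrable M (\<lambda>\<omega>. \<bar>Y \<omega>\<bar> powr q)"
proof (rule Bochner_Integration.integrable_bound)
  show "integrable M (\<lambda>\<omega>. 1 + \<bar>Y \<omega>\<bar> powr p)" using assms by simp
  show "AE \<omega> in M. norm (\<bar>Y \<omega>\<bar> powr q) \<le> norm (1 + \<bar>Y \<omega>\<bar> powr p)"
    using powr_le_truncated[of 1 _ q p] assms by (auto intro!: AE_I2)
qed measurable

lemma expectation_abs_powr_le:
  fixes Y :: "'a \<Rightarrow> real"
  assumes [measurable]: "random_variable borel Y"
    and int: "integrable M (\<lambda>\<omega>. \<bar>Y \<omega>\<bar> powr p)"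
    and le: "expectation (\<lambda>\<omega>. \<bar>Y \<omega>\<bar> powr p) \<le> s powr p"
    and "0 < s" "0 \<le> q" "q \<le> p"
  shows "expectation (\<lambda>\<omega>. \<bar>Y \<omega>\<bar> powr q) \<le> 2 * s powr q"
proof -
  have "expectation (\<lambda>\<omega>. \<bar>Y \<omega>\<bar> powr q)
      \<le> expectation (\<lambda>\<omega>. s powr q + s powr (q - p) * \<bar>Y \<omega>\<bar> powr p)"
    using assms integrable_abs_powr_le[OF assms(1) int, of q]
    by (intro integral_mono powr_le_truncated) auto
  also have "\<dots> = s powr q + s powr (q - p) * expectation (\<lambda>\<omega>. \<bar>Y \<omega>\<bar> powr p)"
    using int by (simp add: prob_space)
  also have "\<dots> \<le> s powr q + s powr (q - p) * s powr p"
    using le by (intro add_left_mono mult_left_mono) auto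
  also have "\<dots> = 2 * s powr q" by (simp flip: powr_add)
  finally show ?thesis .
qed

text \<open>The one-step estimate: integrate \<open>abs_powr_add_le\<close> with \<open>a = S\<close> and \<open>b = Y\<close>. By independence
  the linear term factors and is killed by \<open>E Y = 0\<close>, and the quadratic term factors as well.\<close>

lemma indep_add_moment:
  fixes S Y :: "'a \<Rightarrow> real"
  assumes indep: "indep_var borel Y borel S" and p: "2 \<le> p"
    and S: "integrable M (\<lambda>\<omega>. \<bar>S \<omega>\<bar> powr p)"
    and Y: "integrable M (\<lambda>\<omega>. \<bar>Y \<omega>\<bar> powr p)"
    and mean: "expectation Y = 0"
  shows "integrable M (\<lambda>\<omega>. \<bar>S \<omega> + Y \<omega>\<bar> powr p)"
    and "expectation (\<lambda>\<omega>. \<bar>S \<omega> + Y \<omega>\<bar> powr p) \<le> expectation (\<lambda>\<omega>. \<bar>S \<omega>\<bar> powr p)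
      + p\<^sup>2 * 3 powr p * (expectation (\<lambda>\<omega>. \<bar>S \<omega>\<bar> powr (p - 2)) * expectation (\<lambda>\<omega>. (Y \<omega>)\<^sup>2)
                       + expectation (\<lambda>\<omega>. \<bar>Y \<omega>\<bar> powr p))"
proof -
  have [measurable]: "random_variable borel S" "random_variable borel Y"
    using indep by (blast dest: indep_var_rv1 indep_var_rv2)+
  \<comment> \<open>up to the factor \<open>p\<close>, the derivative of \<open>\<bar>u\<bar> powr p\<close>\<close>
  define D where "D u = sgn u * \<bar>u\<bar> powr (p - 1)" for u :: real
  have [measurable]: "D \<in> borel_measurable borel" unfolding D_def by measurable
  have intD: "integrable M (\<lambda>\<omega>. D (S \<omega>))"
  proof (rule Bochner_Integration.integrable_bound)
    show "integrable M (\<lambda>\<omega>. \<bar>S \<omega>\<bar> powr (p - 1))"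
      using integrable_abs_powr_le[OF _ S, of "p - 1"] p by simp
    show "AE \<omega> in M. norm (D (S \<omega>)) \<le> norm (\<bar>S \<omega>\<bar> powr (p - 1))"
      by (auto intro!: AE_I2 simp: D_def abs_mult sgn_if)
  qed measurable
  have intY: "integrable M Y"
  proof (rule Bochner_Integration.integrable_bound)
    show "integrable M (\<lambda>\<omega>. \<bar>Y \<omega>\<bar> powr 1)"
      using integrable_abs_powr_le[OF _ Y, of 1] p by simp
  qed auto
  have intY2: "integrable M (\<lambda>\<omega>. (Y \<omega>)\<^sup>2)"
    using integrable_abs_powr_le[OF _ Y, of 2] p by simp
  have intS2: "integrable M (\<lambda>\<omega>. \<bar>S \<omega>\<bar> powr (p - 2))"
    using integrable_abs_powr_le[OF _ S, of "p - 2"] p by simp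
  have ind1: "indep_var borel Y borel (\<lambda>\<omega>. D (S \<omega>))"
    using indep_var_compose[OF indep, of "\<lambda>y. y" borel D borel] by (simp add: comp_def)
  have ind2: "indep_var borel (\<lambda>\<omega>. (Y \<omega>)\<^sup>2) borel (\<lambda>\<omega>. \<bar>S \<omega>\<bar> powr (p - 2))"
    using indep_var_compose[OF indep, of "\<lambda>y. y\<^sup>2" borel "\<lambda>u. \<bar>u\<bar> powr (p - 2)" borel]
    by (simp add: comp_def)
  have int1: "integrable M (\<lambda>\<omega>. Y \<omega> * D (S \<omega>))"
    by (rule indep_var_integrable[OF ind1 intY intD])
  have int2: "integrable M (\<lambda>\<omega>. (Y \<omega>)\<^sup>2 * \<bar>S \<omega>\<bar> powr (p - 2))"
    by (rule indep_var_integrable[OF ind2 intY2 intS2])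
  have E1: "expectation (\<lambda>\<omega>. Y \<omega> * D (S \<omega>)) = 0"
    using indep_var_lebesgue_integral[OF ind1 intY intD] mean by simp
  have E2: "expectation (\<lambda>\<omega>. (Y \<omega>)\<^sup>2 * \<bar>S \<omega>\<bar> powr (p - 2))
      = expectation (\<lambda>\<omega>. (Y \<omega>)\<^sup>2) * expectation (\<lambda>\<omega>. \<bar>S \<omega>\<bar> powr (p - 2))"
    by (rule indep_var_lebesgue_integral[OF ind2 intY2 intS2])
  define g where "g \<omega> = \<bar>S \<omega>\<bar> powr p + p * (Y \<omega> * D (S \<omega>))
           + p\<^sup>2 * 3 powr p * ((Y \<omega>)\<^sup>2 * \<bar>S \<omega>\<bar> powr (p - 2) + \<bar>Y \<omega>\<bar> powr p)" for \<omega>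
  have le: "\<bar>S \<omega> + Y \<omega>\<bar> powr p \<le> g \<omega>" for \<omega>
    using abs_powr_add_le[OF p, of "S \<omega>" "Y \<omega>"] by (simp add: g_def D_def mult_ac)
  have intg: "integrable M g"
    unfolding g_def using S Y int1 int2 by simp
  show int: "integrable M (\<lambda>\<omega>. \<bar>S \<omega> + Y \<omega>\<bar> powr p)"
    using le by (intro Bochner_Integration.integrable_bound[OF intg]) (auto intro!: AE_I2 order_trans[OF le abs_ge_self])
  have "expectation (\<lambda>\<omega>. \<bar>S \<omega> + Y \<omega>\<bar> powr p) \<le> expectation g"
    by (intro integral_mono int intg le)
  also have "\<dots> = expectation (\<lambda>\<omega>. \<bar>S \<omega>\<bar> powr p)
      + p\<^sup>2 * 3 powr p * (expectation (\<lambda>\<omega>. \<bar>S \<omega>\<bar> powr (p - 2)) * expectation (\<lambda>\<omega>. (Y \<omega>)\<^sup>2)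
                       + expectation (\<lambda>\<omega>. \<bar>Y \<omega>\<bar> powr p))"
    unfolding g_def using S Y int1 int2 by (simp add: E1 E2 mult_ac)
  finally show "expectation (\<lambda>\<omega>. \<bar>S \<omega> + Y \<omega>\<bar> powr p) \<le> \<dots>" .
qed

text \<open>Induction on \<open>n\<close>. With \<open>b\<^sup>2 = 8 C L\<^sup>2\<close> and \<open>s = b \<surd>n\<close>, the one-step estimate adds at most
  \<open>C (4 + 1) L\<^sup>2 s\<^sup>p\<^sup>-\<^sup>2\<close>, which is below \<open>b\<^sup>2 s\<^sup>p\<^sup>-\<^sup>2\<close>, and
  \<open>s\<^sup>p + b\<^sup>2 s\<^sup>p\<^sup>-\<^sup>2 = (n + 1) b\<^sup>2 s\<^sup>p\<^sup>-\<^sup>2 \<le> (b \<surd>(n + 1))\<^sup>p\<close>. The explicit constant is increasing in \<open>p\<close>,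
  which makes it uniform over bounded ranges of exponents.\<close>

lemma centered_indep_sum_moment:
  fixes X :: "nat \<Rightarrow> 'a \<Rightarrow> real"
  assumes indep: "indep_vars (\<lambda>_. borel) X {1..}" and p: "2 \<le> p" and L: "0 < L"
    and mean: "\<And>k. k \<ge> 1 \<Longrightarrow> expectation (X k) = 0"
    and int: "\<And>k. k \<ge> 1 \<Longrightarrow> integrable M (\<lambda>\<omega>. \<bar>X k \<omega>\<bar> powr p)"
    and mom: "\<And>k. k \<ge> 1 \<Longrightarrow> expectation (\<lambda>\<omega>. \<bar>X k \<omega>\<bar> powr p) \<le> L powr p"
    and n: "n \<ge> 1"
  shows "integrable M (\<lambda>\<omega>. \<bar>\<Sum>k=1..n. X k \<omega>\<bar> powr p) \<and>
    expectation (\<lambda>\<omega>. \<bar>\<Sum>k=1..n. X k \<omega>\<bar> powr p)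
      \<le> (sqrt (8 * p\<^sup>2 * 3 powr p) * L * sqrt n) powr p"
proof -
  define C where "C = p\<^sup>2 * 3 powr p"
  have "1 \<le> C"
  proof -
    have "1 * 1 \<le> p\<^sup>2 * 3 powr p"
      using p by (intro mult_mono) (auto simp: ge_one_powr_ge_zero)
    then show ?thesis by (simp add: C_def)
  qed
  define b where "b = sqrt (8 * C) * L"
  have b0: "0 < b" using \<open>1 \<le> C\<close> L by (simp add: b_def)
  have b2: "b\<^sup>2 = 8 * C * L\<^sup>2" using \<open>1 \<le> C\<close> by (simp add: b_def power_mult_distrib)
  have Lb: "L \<le> b"
  proof -
    have "1 \<le> sqrt (8 * C)" using \<open>1 \<le> C\<close> by simp
    then show ?thesis using L by (simp add: b_def)
  qed
  have rv: "random_variable borel (X k)" if "k \<ge> 1" for k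
    using indep that by (auto simp: indep_vars_def)
  have "integrable M (\<lambda>\<omega>. \<bar>\<Sum>k=1..n. X k \<omega>\<bar> powr p) \<and>
      expectation (\<lambda>\<omega>. \<bar>\<Sum>k=1..n. X k \<omega>\<bar> powr p) \<le> (b * sqrt n) powr p"
    using n
  proof (induction n rule: dec_induct)
    case base
    have "L powr p \<le> b powr p" using Lb L p by (intro powr_mono2) auto
    then show ?case using int[of 1] mom[of 1] by (auto intro: order_trans)
  next
    case (step n)
    define S where "S \<omega> = (\<Sum>k=1..n. X k \<omega>)" for \<omega>
    define Y where "Y = X (Suc n)"
    define s where "s = b * sqrt n"
    have s0: "0 < s" using b0 step by (simp add: s_def)
    have bs: "b \<le> s" using b0 step by (simp add: s_def)
    have [measurable]: "random_variable borel S" "random_variable borel Y"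
      unfolding S_def Y_def using rv by (auto intro!: borel_measurable_sum)
    have ind: "indep_var borel Y borel S"
      unfolding S_def Y_def
      by (rule indep_vars_sum) (auto intro: indep_vars_subset[OF indep])
    have IH: "integrable M (\<lambda>\<omega>. \<bar>S \<omega>\<bar> powr p)" "expectation (\<lambda>\<omega>. \<bar>S \<omega>\<bar> powr p) \<le> s powr p"
      using step.IH by (auto simp: S_def s_def)
    have Y: "integrable M (\<lambda>\<omega>. \<bar>Y \<omega>\<bar> powr p)" "expectation (\<lambda>\<omega>. \<bar>Y \<omega>\<bar> powr p) \<le> L powr p"
      "expectation Y = 0"
      using int mom mean by (auto simp: Y_def)
    have ES: "expectation (\<lambda>\<omega>. \<bar>S \<omega>\<bar> powr (p - 2)) \<le> 2 * s powr (p - 2)"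
      using p s0 by (intro expectation_abs_powr_le[OF _ IH]) auto
    have EY: "expectation (\<lambda>\<omega>. (Y \<omega>)\<^sup>2) \<le> 2 * L\<^sup>2"
      using expectation_abs_powr_le[OF _ Y(1,2) L, of 2] p L by simp
    \<comment> \<open>absorb the term \<open>E |Y|\<^sup>p\<close> into the quadratic one, using \<open>L \<le> b \<le> s\<close>\<close>
    have "L powr p = L\<^sup>2 * L powr (p - 2)"
      using L by (simp add: powr_diff)
    also have "\<dots> \<le> L\<^sup>2 * s powr (p - 2)"
      using Lb bs L p by (intro mult_left_mono powr_mono2) auto
    finally have Lp: "expectation (\<lambda>\<omega>. \<bar>Y \<omega>\<bar> powr p) \<le> L\<^sup>2 * s powr (p - 2)"
      using Y(2) by linarith
    have "expectation (\<lambda>\<omega>. \<bar>S \<omega> + Y \<omega>\<bar> powr p) \<le> expectation (\<lambda>\<omega>. \<bar>S \<omega>\<bar> powr p)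
      + C * (expectation (\<lambda>\<omega>. \<bar>S \<omega>\<bar> powr (p - 2)) * expectation (\<lambda>\<omega>. (Y \<omega>)\<^sup>2)
             + expectation (\<lambda>\<omega>. \<bar>Y \<omega>\<bar> powr p))"
      unfolding C_def by (rule indep_add_moment(2)[OF ind p IH(1) Y(1,3)])
    also have "\<dots> \<le> s powr p + C * ((2 * s powr (p - 2)) * (2 * L\<^sup>2) + L\<^sup>2 * s powr (p - 2))"
      using IH(2) ES EY Lp \<open>1 \<le> C\<close>
      by (intro add_mono mult_left_mono mult_mono) auto
    also have "\<dots> \<le> s powr p + b\<^sup>2 * s powr (p - 2)"
      using \<open>1 \<le> C\<close> by (simp add: b2 algebra_simps)
    also have "\<dots> = (b * sqrt (Suc n))\<^sup>2 * s powr (p - 2)"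
    proof -
      have "s powr p = s\<^sup>2 * s powr (p - 2)" using s0 by (simp add: powr_diff)
      then show ?thesis by (simp add: s_def power_mult_distrib algebra_simps)
    qed
    also have "\<dots> \<le> (b * sqrt (Suc n))\<^sup>2 * (b * sqrt (Suc n)) powr (p - 2)"
      using b0 p s0 by (intro mult_left_mono powr_mono2) (auto simp: s_def)
    also have "\<dots> = (b * sqrt (Suc n)) powr p"
      using b0 by (simp add: powr_diff)
    finally have "expectation (\<lambda>\<omega>. \<bar>S \<omega> + Y \<omega>\<bar> powr p) \<le> (b * sqrt (Suc n)) powr p" .
    moreover have "integrable M (\<lambda>\<omega>. \<bar>S \<omega> + Y \<omega>\<bar> powr p)"
      by (rule indep_add_moment(1)[OF ind p IH(1) Y(1,3)])
    ultimately show ?case by (simp add: S_def Y_def)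
  qed
  then show ?thesis by (simp add: b_def C_def mult.assoc)
qed

lemma centered_indep_sum_tail:
  fixes X :: "nat \<Rightarrow> 'a \<Rightarrow> real"
  assumes indep: "indep_vars (\<lambda>_. borel) X {1..}" and p: "2 \<le> p" and L: "0 < L"
    and mean: "\<And>k. k \<ge> 1 \<Longrightarrow> expectation (X k) = 0"
    and int: "\<And>k. k \<ge> 1 \<Longrightarrow> integrable M (\<lambda>\<omega>. \<bar>X k \<omega>\<bar> powr p)"
    and mom: "\<And>k. k \<ge> 1 \<Longrightarrow> expectation (\<lambda>\<omega>. \<bar>X k \<omega>\<bar> powr p) \<le> L powr p"
    and n: "n \<ge> 1" and x: "0 < x"
  shows "prob {\<omega> \<in> space M. \<bar>real n powr (-1/2) * (\<Sum>k=1..n. X k \<omega>)\<bar> \<ge> x}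
      \<le> (sqrt (8 * p\<^sup>2 * 3 powr p) * L / x) powr p"
proof -
  let ?S = "\<lambda>\<omega>. \<Sum>k=1..n. X k \<omega>"
  have rv: "random_variable borel (X k)" if "k \<ge> 1" for k
    using indep that by (auto simp: indep_vars_def)
  have norm: "real n powr (-1/2) = 1 / sqrt n"
    using n by (simp add: powr_minus_divide powr_half_sqrt)
  have iff: "\<bar>real n powr (-1/2) * ?S \<omega>\<bar> \<ge> x \<longleftrightarrow> \<bar>?S \<omega>\<bar> powr p \<ge> (x * sqrt n) powr p" for \<omega>
  proof -
    have "\<bar>real n powr (-1/2) * ?S \<omega>\<bar> \<ge> x \<longleftrightarrow> \<bar>?S \<omega>\<bar> \<ge> x * sqrt n"
      using n unfolding norm by (simp add: abs_mult field_simps)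
    also have "\<dots> \<longleftrightarrow> \<bar>?S \<omega>\<bar> powr p \<ge> (x * sqrt n) powr p"
    proof
      assume "x * sqrt n \<le> \<bar>?S \<omega>\<bar>"
      then show "(x * sqrt n) powr p \<le> \<bar>?S \<omega>\<bar> powr p"
        using x p by (intro powr_mono2) auto
    next
      assume "(x * sqrt n) powr p \<le> \<bar>?S \<omega>\<bar> powr p"
      then show "x * sqrt n \<le> \<bar>?S \<omega>\<bar>"
        using p powr_less_mono2[of p "\<bar>?S \<omega>\<bar>" "x * sqrt n"] by fastforce
    qed
    finally show ?thesis .
  qed
  note * = centered_indep_sum_moment[OF indep p L mean int mom n]
  have "prob {\<omega> \<in> space M. \<bar>?S \<omega>\<bar> powr p \<ge> (x * sqrt n) powr p}
      \<le> expectation (\<lambda>\<omega>. \<bar>?S \<omega>\<bar> powr p) / (x * sqrt n) powr p"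
    using * x n by (intro integral_Markov_inequality_measure[where A = "{}"]) auto
  also have "\<dots> \<le> (sqrt (8 * p\<^sup>2 * 3 powr p) * L * sqrt n) powr p / (x * sqrt n) powr p"
    using * by (intro divide_right_mono) auto
  also have "\<dots> = (sqrt (8 * p\<^sup>2 * 3 powr p) * L / x) powr p"
    using L x p n by (simp flip: powr_divide)
  finally show ?thesis by (simp only: iff)
qed

end

section \<open>Tails in terms of the norm of \<open>G(\<nu>)\<close>\<close>

lemma nn_integral_le_of_Lp_norm_le:
  assumes "Lp_norm M p \<xi> \<le> ennreal L" "0 \<le> L" "0 < p"
  shows "(\<integral>\<^sup>+ \<omega>. ennreal (\<bar>\<xi> \<omega>\<bar> powr p) \<partial>M) \<le> ennreal (L powr p)"
proof -
  define I where "I = (\<integral>\<^sup>+ \<omega>. ennreal (\<bar>\<xi> \<omega>\<bar> powr p) \<partial>M)"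
  have le: "ennreal_powr I (1 / p) \<le> ennreal L"
    using assms(1) by (simp add: Lp_norm_def I_def)
  then have fin: "I \<noteq> \<infinity>"
    by (auto simp: ennreal_powr_def top_unique)
  with le have "enn2real I powr (1 / p) \<le> L"
    using assms(2) by (simp add: ennreal_powr_def)
  then have "(enn2real I powr (1 / p)) powr p \<le> L powr p"
    using assms(3) by (intro powr_mono2) auto
  then have "enn2real I \<le> L powr p"
    using assms(3) by (simp add: powr_powr)
  then have "ennreal (enn2real I) \<le> ennreal (L powr p)"
    by (rule ennreal_leI)
  then show ?thesis
    unfolding I_def[symmetric] using fin by (cases I) auto
qed

lemma G_space_moment_bound:
  assumes adm: "admissible \<nu> r" and \<xi>: "\<xi> \<in> G_space M \<nu> r"
  shows "\<exists>K>0. \<forall>p\<in>{2<..<r}.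
           (\<integral>\<^sup>+ \<omega>. ennreal (\<bar>\<xi> \<omega>\<bar> powr p) \<partial>M) \<le> ennreal ((K * enn2real (\<nu> p)) powr p)"
proof -
  \<comment> \<open>the added \<open>1\<close> keeps \<open>K\<close> positive when the norm vanishes\<close>
  define K where "K = enn2real (G_norm M \<nu> r \<xi>) + 1"
  have K0: "0 < K" by (simp add: K_def add_nonneg_pos)
  have fin: "G_norm M \<nu> r \<xi> < top" using \<xi> by (simp add: G_space_def)
  then have K: "G_norm M \<nu> r \<xi> \<le> ennreal K"
    by (cases "G_norm M \<nu> r \<xi>") (auto simp: K_def intro!: ennreal_leI)
  show ?thesis
  proof (intro exI[of _ K] conjI ballI K0)
    fix p assume p: "p \<in> {2<..<r}"
    have \<nu>: "0 < \<nu> p" "\<nu> p < top" using adm p by (auto simp: admissible_def)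
    have "Lp_norm M p \<xi> / \<nu> p \<le> G_norm M \<nu> r \<xi>"
      unfolding G_norm_def using p by (rule SUP_upper)
    with K have "Lp_norm M p \<xi> / \<nu> p \<le> ennreal K" by order
    then have "Lp_norm M p \<xi> / \<nu> p * \<nu> p \<le> ennreal K * \<nu> p"
      by (rule mult_right_mono) simp
    moreover have "Lp_norm M p \<xi> / \<nu> p * \<nu> p = Lp_norm M p \<xi>"
      using \<nu> by (simp add: ennreal_divide_times ennreal_mult_divide_eq flip: ennreal_times_divide)
    moreover have "ennreal K * \<nu> p = ennreal (K * enn2real (\<nu> p))"
      using K0 \<nu> by (simp add: ennreal_mult)
    ultimately show "(\<integral>\<^sup>+ \<omega>. ennreal (\<bar>\<xi> \<omega>\<bar> powr p) \<partial>M) \<le> ennreal ((K * enn2real (\<nu> p)) powr p)"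
      using p K0 by (intro nn_integral_le_of_Lp_norm_le) auto
  qed
qed

text \<open>The mean and the \<open>p\<close>-th absolute moment depend only on the law, so they pass from \<open>\<xi>\<close> to its
  copies even though these live on another probability space.\<close>

lemma independent_copies_tail:
  assumes M: "\<xi> \<in> borel_measurable M" "prob_space.expectation M \<xi> = 0"
    and N: "prob_space N" "independent_copies M \<xi> N X"
    and p: "2 \<le> p" and L: "0 < L"
    and mom: "(\<integral>\<^sup>+ \<omega>. ennreal (\<bar>\<xi> \<omega>\<bar> powr p) \<partial>M) \<le> ennreal (L powr p)"
    and n: "n \<ge> 1" and x: "0 < x"
  shows "measure N {\<omega> \<in> space N. \<bar>real n powr (-1/2) * (\<Sum>k=1..n. X k \<omega>)\<bar> \<ge> x}
      \<le> (sqrt (8 * p\<^sup>2 * 3 powr p) * L / x) powr p"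
proof -
  interpret N: prob_space N by fact
  have indep: "N.indep_vars (\<lambda>_. borel) X {1..}"
    using N(2) by (simp add: independent_copies_def)
  have law: "distr N borel (X k) = distr M borel \<xi>" if "k \<ge> 1" for k
    using N(2) that by (simp add: independent_copies_def)
  have rv: "X k \<in> borel_measurable N" if "k \<ge> 1" for k
    using indep that by (auto simp: N.indep_vars_def)
  have mean: "N.expectation (X k) = 0" if "k \<ge> 1" for k
  proof -
    have "N.expectation (X k) = (\<integral>y. y \<partial>distr N borel (X k))"
      using rv[OF that] by (subst integral_distr) auto
    also have "\<dots> = prob_space.expectation M \<xi>"
      unfolding law[OF that] using M(1) by (subst integral_distr) auto
    finally show ?thesis using M(2) by simp
  qed
  have nn: "(\<integral>\<^sup>+ \<omega>. ennreal (\<bar>X k \<omega>\<bar> powr p) \<partial>N) \<le> ennreal (L powr p)" if "k \<ge> 1" for k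
  proof -
    have "(\<integral>\<^sup>+ \<omega>. ennreal (\<bar>X k \<omega>\<bar> powr p) \<partial>N)
        = (\<integral>\<^sup>+ y. ennreal (\<bar>y\<bar> powr p) \<partial>distr N borel (X k))"
      using rv[OF that] by (subst nn_integral_distr) auto
    also have "\<dots> = (\<integral>\<^sup>+ \<omega>. ennreal (\<bar>\<xi> \<omega>\<bar> powr p) \<partial>M)"
      unfolding law[OF that] using M(1) by (subst nn_integral_distr) auto
    finally show ?thesis using mom by simp
  qed
  have int: "integrable N (\<lambda>\<omega>. \<bar>X k \<omega>\<bar> powr p)" if "k \<ge> 1" for k
    using rv[OF that] nn[OF that]
    by (intro integrableI_nonneg) (auto intro: le_less_trans)
  have mom': "N.expectation (\<lambda>\<omega>. \<bar>X k \<omega>\<bar> powr p) \<le> L powr p" if "k \<ge> 1" for k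
    using nn[OF that] nn_integral_eq_integral[OF int[OF that]] by simp
  show ?thesis
    by (rule N.centered_indep_sum_tail[OF indep p L mean int mom' n x])
qed

text \<open>Admissibility bounds \<open>\<nu>\<close> below explicitly only on \<open>(2, r)\<close>; on \<open>[1, 2]\<close> a positive lower bound
  comes from compactness.\<close>

lemma admissible_lower_bound:
  assumes "2 < r" "admissible \<nu> r"
  obtains a where "0 < a" "\<And>p. p \<in> {1..2} \<Longrightarrow> a \<le> enn2real (\<nu> p)"
proof -
  have cont: "continuous_on {1..2} \<nu>"
    using assms by (auto simp: admissible_def intro: continuous_on_subset)
  obtain p0 where p0: "p0 \<in> {1..2}" "\<forall>p\<in>{1..2}. \<nu> p0 \<le> \<nu> p"
    using continuous_attains_inf[OF compact_Icc _ cont] by auto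
  have fin: "0 < \<nu> p" "\<nu> p < top" if "p \<in> {1..2}" for p
    using assms that by (auto simp: admissible_def)
  show ?thesis
  proof
    show "0 < enn2real (\<nu> p0)" using fin[OF p0(1)] by (simp add: enn2real_positive_iff)
    show "enn2real (\<nu> p0) \<le> enn2real (\<nu> p)" if "p \<in> {1..2}" for p
      using p0 fin[OF that] that by (intro enn2real_mono) auto
  qed
qed

theorem theorem4p2:
  fixes r :: real and \<nu> :: "real \<Rightarrow> ennreal" and \<mu> :: "real measure"
  assumes "2 < r" and "admissible \<nu> r"
  shows "\<exists>C::real. \<forall>(M :: 'a measure) \<xi> (N :: 'b measure) X.
           prob_space M \<longrightarrow> \<xi> \<in> G_space M \<nu> r \<longrightarrow> prob_space.expectation M \<xi> = 0 \<longrightarrow>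
           distr M borel \<xi> = \<mu> \<longrightarrow>
           prob_space N \<longrightarrow> independent_copies M \<xi> N X \<longrightarrow>
           (\<forall>x>0. U_tail N X x \<le> C * T_fun \<nu> r x)"
proof -
  \<comment> \<open>The constant must serve all \<open>M\<close> and \<open>\<xi>\<close> at once, so the moment bound is phrased in terms of the law
    \<open>\<mu>\<close>. If no \<open>K\<close> bounds the moments of \<open>\<mu>\<close>, then no \<open>\<xi> \<in> G(\<nu>)\<close> has law \<open>\<mu>\<close>.\<close>
  define bounded where "bounded K \<longleftrightarrow> 0 < K \<and> (\<forall>p\<in>{2<..<r}.
    (\<integral>\<^sup>+ y. ennreal (\<bar>y\<bar> powr p) \<partial>\<mu>) \<le> ennreal ((K * enn2real (\<nu> p)) powr p))" for K
  have moment_law: "(\<integral>\<^sup>+ y. ennreal (\<bar>y\<bar> powr p) \<partial>\<mu>) = (\<integral>\<^sup>+ \<omega>. ennreal (\<bar>\<xi> \<omega>\<bar> powr p) \<partial>M)"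
    if "\<xi> \<in> G_space M \<nu> r" "distr M borel \<xi> = \<mu>" for M :: "'a measure" and \<xi> p
    using that by (auto simp: G_space_def nn_integral_distr)
  have ex_bounded: "\<exists>K. bounded K"
    if "\<xi> \<in> G_space M \<nu> r" "distr M borel \<xi> = \<mu>" for M :: "'a measure" and \<xi>
    using G_space_moment_bound[OF assms(2) that(1)] moment_law[OF that]
    by (simp add: bounded_def)
  show ?thesis
  proof (cases "\<exists>K. bounded K")
    case False
    then show ?thesis using ex_bounded by blast
  next
    case True
    then obtain K where K: "bounded K" by blast
    have K0: "0 < K" using K by (simp add: bounded_def)
    obtain a where a: "0 < a" "\<And>p. p \<in> {1..2} \<Longrightarrow> a \<le> enn2real (\<nu> p)"
      using admissible_lower_bound[OF assms] by blast
    have \<nu>0: "0 < enn2real (\<nu> p)" if "p \<in> {1..<r}" for p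
      using assms(2) that by (auto simp: admissible_def enn2real_positive_iff)
    define c where "c = sqrt (8 * r\<^sup>2 * 3 powr r) * K"
    \<comment> \<open>any exponent in \<open>(2, r)\<close> would do\<close>
    define q where "q = (2 + r) / 2"
    have q: "q \<in> {2<..<r}" using assms(1) by (simp add: q_def)
    \<comment> \<open>\<open>G\<close> dominates \<open>c\<close> for the exponents above 2 and \<open>c \<nu>(q) / a\<close> for those up to 2; \<open>G \<ge> 1\<close>
      makes \<open>G\<^sup>p \<le> G\<^sup>r\<close>\<close>
    define G where "G = max 1 (max c (c * enn2real (\<nu> q) / a))"
    have G: "1 \<le> G" "c \<le> G" "c * enn2real (\<nu> q) / a \<le> G" by (auto simp: G_def)
    have c0: "0 < c" using K0 assms(1) by (simp add: c_def)
    have "U_tail N X x \<le> G powr r * T_fun \<nu> r x"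
      if M: "\<xi> \<in> G_space M \<nu> r" "prob_space.expectation M \<xi> = 0"
        and law: "distr M borel \<xi> = \<mu>"
        and N: "prob_space N" "independent_copies M \<xi> N X" and x: "0 < x"
      for M :: "'a measure" and \<xi> and N :: "'b measure" and X x
    proof -
      interpret N: prob_space N by fact
      define P where "P n = measure N {\<omega> \<in> space N. \<bar>real n powr (-1/2) * (\<Sum>k=1..n. X k \<omega>)\<bar> \<ge> x}"
        for n
      have high: "P n \<le> (c * enn2real (\<nu> p) / x) powr p" if n: "n \<ge> 1" and p: "p \<in> {2<..<r}" for n p
      proof -
        have "P n \<le> (sqrt (8 * p\<^sup>2 * 3 powr p) * (K * enn2real (\<nu> p)) / x) powr p"
          unfolding P_def using M N n x p K K0 \<nu>0[of p] moment_law[OF M(1) law]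
          by (intro independent_copies_tail) (auto simp: G_space_def bounded_def)
        also have "\<dots> \<le> (sqrt (8 * r\<^sup>2 * 3 powr r) * (K * enn2real (\<nu> p)) / x) powr p"
          using p x K0 by (intro powr_mono2 divide_right_mono mult_right_mono
              real_sqrt_le_mono mult_mono power_mono powr_mono) auto
        finally show ?thesis by (simp add: c_def mult.assoc)
      qed
      have low: "P n \<le> (c * enn2real (\<nu> q) / x) powr p" if n: "n \<ge> 1" and p: "p \<in> {1<..2}" for n p
      proof (cases "c * enn2real (\<nu> q) / x \<ge> 1")
        case True
        have "P n \<le> 1" by (simp add: P_def)
        also have "\<dots> \<le> (c * enn2real (\<nu> q) / x) powr p"
          using True p by (intro ge_one_powr_ge_zero) auto
        finally show ?thesis .
      next
        case False
        have "P n \<le> (c * enn2real (\<nu> q) / x) powr q" by (rule high[OF n q])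
        also have "\<dots> \<le> (c * enn2real (\<nu> q) / x) powr p"
          using False p q c0 x by (intro powr_mono') auto
        finally show ?thesis .
      qed
      have P: "P n \<le> G powr r * (enn2real (\<nu> p) powr p / x powr p)"
        if n: "n \<ge> 1" and p: "p \<in> {1<..<r}" for n p
      proof -
        have "P n \<le> (G * enn2real (\<nu> p) / x) powr p"
        proof (cases "p \<le> 2")
          case True
          have "c * enn2real (\<nu> q) = c * enn2real (\<nu> q) / a * a" using a(1) by simp
          also have "\<dots> \<le> G * enn2real (\<nu> p)"
            using G a(1) a(2)[of p] p True by (intro mult_mono) auto
          finally have "(c * enn2real (\<nu> q) / x) powr p \<le> (G * enn2real (\<nu> p) / x) powr p"
            using c0 p x by (intro powr_mono2 divide_right_mono) auto
          then show ?thesis using low[OF n, of p] p True by auto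
        next
          case False
          have "(c * enn2real (\<nu> p) / x) powr p \<le> (G * enn2real (\<nu> p) / x) powr p"
            using G c0 p x by (intro powr_mono2 divide_right_mono mult_right_mono) auto
          then show ?thesis using high[OF n, of p] p False by auto
        qed
        also have "\<dots> = G powr p * (enn2real (\<nu> p) powr p / x powr p)"
          using G x by (simp add: powr_mult powr_divide)
        also have "\<dots> \<le> G powr r * (enn2real (\<nu> p) powr p / x powr p)"
          using G p by (intro mult_right_mono powr_mono) auto
        finally show ?thesis .
      qed
      have "U_tail N X x / G powr r \<le> T_fun \<nu> r x"
        unfolding T_fun_def
      proof (rule cINF_greatest)
        show "{1<..<r} \<noteq> {}" using assms(1) by (simp add: not_le)
      next
        fix p assume p: "p \<in> {1<..<r}"
        have "U_tail N X x \<le> G powr r * (enn2real (\<nu> p) powr p / x powr p)"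
          unfolding U_tail_def using P[OF _ p] by (intro cSUP_least) (auto simp: P_def)
        then show "U_tail N X x / G powr r \<le> enn2real (\<nu> p) powr p / x powr p"
          using G by (simp add: divide_le_eq mult.commute)
      qed
      then show ?thesis using G by (simp add: divide_le_eq mult.commute)
    qed
    then show ?thesis by blast
  qed
qed

end
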